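(* Let $N\in\mathbb{Z}_{\ge0}$, let $k=(k_1,k_2)$ with $k_1,k_2\ge0$, put $\alpha=k_1+k_2-\frac12$, $\beta=k_2-\frac12$, $\rho(k)=\frac12(k_1+2k_2)$, $c_N(k)=\frac{k_1}{1+2N+2\rho(k)}$ and $x=\frac12(z+z^{-1})$. Then $$E(-N,k)(z)=\frac{2^{2N-1}N!}{(N+\alpha+\beta+2)_N}\left(P_N^{(\alpha+1,\beta)}(x)+P_N^{(\alpha,\beta+1)}(x)-z\left(P_N^{(\alpha+1,\beta)}(x)-P_N^{(\alpha,\beta+1)}(x)\right)\right)$$ and $$E(N+1,k)(z)=\frac{z\,2^{2N-1}N!}{(N+\alpha+\beta+2)_N}\left(P_N^{(\alpha+1,\beta)}(x)+P_N^{(\alpha,\beta+1)}(x)-c_N(k)\left(P_N^{(\alpha+1,\beta)}(x)-P_N^{(\alpha,\beta+1)}(x)\right)\right)$$ $$\qquad+\frac{2^{2N-1}N!}{(N+\alpha+\beta+2)_N}\left(c_N(k)\left(P_N^{(\alpha+1,\beta)}(x)+P_N^{(\alpha,\beta+1)}(x)\right)-P_N^{(\alpha+1,\beta)}(x)+P_N^{(\alpha,\beta+1)}(x)\right).$$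
   Context: Pochhammer symbol: $(a)_0=1$, $(a)_N=a(a+1)\cdots(a+N-1)$. Classical Jacobi polynomials: $P_n^{(\alpha,\beta)}(x)=\frac{(\alpha+1)_n}{n!}\,{}_2F_1\left(-n,\,n+\alpha+\beta+1;\,\alpha+1;\,\frac{1-x}{2}\right)$. Non-symmetric Jacobi polynomials of type $BC_1$: for $k=(k_1,k_2)$ with real $k_1,k_2\ge0$ put $\delta_k(z)=\left(1-\frac{z+z^{-1}}{2}\right)^{k_1}\left(1-\frac{z^2+z^{-2}}{2}\right)^{k_2}$ and, on $\mathbb{C}[z^{\pm1}]$, the inner product $(p,q)_k=\int_{S^1}\overline{p(z)}q(z)\delta_k(z)\frac{dz}{iz}$. Order the monomials by $1<z<z^{-1}<z^2<z^{-2}<z^3<\cdots$. For $n\in\mathbb{Z}$, $E(n,k)\in\mathbb{C}[z^{\pm1}]$ is the unique Laurent polynomial with $E(n,k)=z^n+$ (linear combination of monomials smaller than $z^n$) and $(E(n,k),z^j)_k=0$ for all monomials $z^j<z^n$. *)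

theory Defs
  imports
    "HOL-Library.Poly_Mapping"
    "HOL-Analysis.FPS_Convergence"
    "HOL-Complex_Analysis.Contour_Integration"
begin

definition hypergeo_2F1 :: "complex \<Rightarrow> complex \<Rightarrow> complex \<Rightarrow> complex \<Rightarrow> complex" where
  "hypergeo_2F1 a b c x = eval_fps (fps_hypergeo [a, b] [c] 1) x"

text \<open>The upper parameter \<open>- n\<close> makes the hypergeometric series terminate, so this is a
  polynomial in \<open>x\<close>, defined without any condition on convergence.\<close>

definition jacobi_P :: "nat \<Rightarrow> real \<Rightarrow> real \<Rightarrow> complex \<Rightarrow> complex" where
  "jacobi_P n \<alpha> \<beta> x =
     complex_of_real (pochhammer (\<alpha> + 1) n / fact n) *
     hypergeo_2F1 (- of_nat n) (of_nat n + of_real \<alpha> + of_real \<beta> + 1) (of_real \<alpha> + 1) ((1 - x) / 2)"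

text \<open>A Laurent polynomial is the finitely supported map sending an exponent to its coefficient.\<close>

type_synonym laurent_poly = "int \<Rightarrow>\<^sub>0 complex"

definition laurent_monom :: "int \<Rightarrow> laurent_poly" where
  "laurent_monom n = Poly_Mapping.single n 1"

definition laurent_eval :: "laurent_poly \<Rightarrow> complex \<Rightarrow> complex" where
  "laurent_eval p z = (\<Sum>j\<in>Poly_Mapping.keys p. Poly_Mapping.lookup p j * z powi j)"

text \<open>On the unit circle both bases are nonnegative reals, so these are ordinary real powers.
  They vanish only at \<open>z = 1\<close> and \<open>z = -1\<close>; the convention that \<open>0 powr 0\<close> is \<open>0\<close>
  therefore changes the weight only on a set of measure zero.\<close>

definition delta_weight :: "real \<times> real \<Rightarrow> complex \<Rightarrow> complex" where
  "delta_weight = (\<lambda>(k1, k2) z.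
     (1 - (z + inverse z) / 2) powr of_real k1 *
     (1 - (z\<^sup>2 + inverse (z\<^sup>2)) / 2) powr of_real k2)"

definition inner_k :: "real \<times> real \<Rightarrow> laurent_poly \<Rightarrow> laurent_poly \<Rightarrow> complex" where
  "inner_k k p q = contour_integral (circlepath 0 1)
     (\<lambda>z. cnj (laurent_eval p z) * laurent_eval q z * delta_weight k z / (\<i> * z))"

text \<open>The order \<open>1 < z < z\<^sup>-\<^sup>1 < z\<^sup>2 < z\<^sup>-\<^sup>2 < \<dots>\<close>, expressed through exponents.\<close>

definition monom_less :: "int \<Rightarrow> int \<Rightarrow> bool" where
  "monom_less j n \<longleftrightarrow> \<bar>j\<bar> < \<bar>n\<bar> \<or> (\<bar>j\<bar> = \<bar>n\<bar> \<and> n < j)"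

definition is_nonsym_jacobi :: "int \<Rightarrow> real \<times> real \<Rightarrow> laurent_poly \<Rightarrow> bool" where
  "is_nonsym_jacobi n k p \<longleftrightarrow>
     (\<exists>q. p = laurent_monom n + q \<and> (\<forall>j\<in>Poly_Mapping.keys q. monom_less j n)) \<and>
     (\<forall>j. monom_less j n \<longrightarrow> inner_k k p (laurent_monom j) = 0)"

definition nonsym_jacobi_E :: "int \<Rightarrow> real \<times> real \<Rightarrow> laurent_poly" where
  "nonsym_jacobi_E n k = (THE p. is_nonsym_jacobi n k p)"

definition rho :: "real \<times> real \<Rightarrow> real" where
  "rho = (\<lambda>(k1, k2). (k1 + 2 * k2) / 2)"

definition c_coeff :: "nat \<Rightarrow> real \<times> real \<Rightarrow> real" where
  "c_coeff N k = fst k / (1 + 2 * real N + 2 * rho k)"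

end

theory Submission
  imports Defs
begin

text \<open>Put \<open>t = (1 - x) / 2\<close>, \<open>A = P\<^bsub>N\<^esub>\<^bsup>(\<alpha>+1,\<beta>)\<^esup>\<close> and
  \<open>B = P\<^bsub>N\<^esub>\<^bsup>(\<alpha>,\<beta>+1)\<^esup>\<close>. Up to a constant both right-hand sides have the form
  \<open>u (1 - z) A + v (1 + z) B\<close>, with \<open>u = v = 1\<close>, respectively \<open>u = -(1 - c)\<close>, \<open>v = 1 + c\<close>. On the
  circle every \<open>z\<^bsup>j\<^esup>\<close> is \<open>p(t) + z q(t)\<close>, and the part of the integrand that is odd under
  \<open>z \<mapsto> z\<^bsup>-1\<^esup>\<close> integrates to zero, so the inner product becomes
  \<open>2 L((u t A + v (1 - t) B) p) + 2 L((v (1 - t) B - u t A) q)\<close>, where \<open>L\<close> integrates against the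
  Jacobi weight with parameters \<open>(\<alpha>, \<beta>)\<close>. It vanishes for \<open>p, q\<close> of degree less than \<open>N\<close> by
  orthogonality of \<open>A\<close> and \<open>B\<close>. For \<open>z\<^bsup>-N\<^esup>\<close> the polynomial \<open>p\<close> has degree \<open>N\<close>, and \<open>c\<close> is exactly
  the constant for which \<open>u t A + v (1 - t) B\<close> is a multiple of \<open>P\<^bsub>N+1\<^esub>\<^bsup>(\<alpha>,\<beta>)\<^esup>\<close>.

  Orthogonality comes from the Pearson equation, an integration by parts on the circle: it makes the
  Jacobi differential operator symmetric for \<open>L\<close>.\<close>

section \<open>Jacobi polynomials and orthogonality\<close>

text \<open>Throughout, the variable is \<open>t = (1 - x) / 2\<close>, in which the Jacobi differential operator maps
  \<open>t ^ m\<close> to a combination of \<open>t ^ (m - 1)\<close> and \<open>t ^ m\<close> only.\<close>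

definition jacobi_poly :: "nat \<Rightarrow> real \<Rightarrow> real \<Rightarrow> real poly" where
  "jacobi_poly n a b = (\<Sum>j\<le>n. monom (pochhammer (a + 1) n / fact n *
     (pochhammer (- real n) j * pochhammer (real n + a + b + 1) j / (pochhammer (a + 1) j * fact j))) j)"

text \<open>Beyond the degree both sides are 0, because \<open>pochhammer (- real n) j\<close>
  vanishes for \<open>j > n\<close>; coefficient comparisons can therefore ignore the range of the
  sum.\<close>

lemma coeff_jacobi_poly:
  "coeff (jacobi_poly n a b) j = pochhammer (a + 1) n / fact n *
     (pochhammer (- real n) j * pochhammer (real n + a + b + 1) j / (pochhammer (a + 1) j * fact j))"
proof -
  have "coeff (jacobi_poly n a b) j = (\<Sum>i\<le>n. if i = j then pochhammer (a + 1) n / fact n *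
     (pochhammer (- real n) j * pochhammer (real n + a + b + 1) j / (pochhammer (a + 1) j * fact j)) else 0)"
    unfolding jacobi_poly_def by (auto simp: coeff_sum intro!: sum.cong)
  also have "\<dots> = (if j \<le> n then pochhammer (a + 1) n / fact n *
     (pochhammer (- real n) j * pochhammer (real n + a + b + 1) j / (pochhammer (a + 1) j * fact j)) else 0)"
    by simp
  also have "\<dots> = pochhammer (a + 1) n / fact n *
     (pochhammer (- real n) j * pochhammer (real n + a + b + 1) j / (pochhammer (a + 1) j * fact j))"
    by (simp add: pochhammer_of_nat_eq_0_iff)
  finally show ?thesis .
qed

lemma degree_jacobi_poly_le: "degree (jacobi_poly n a b) \<le> n"
  by (rule degree_le) (simp add: coeff_jacobi_poly pochhammer_of_nat_eq_0_iff)

text \<open>This is the ratio of consecutive hypergeometric coefficients, cleared of denominators;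
  \<open>a > -1\<close> keeps these nonzero.\<close>

lemma coeff_jacobi_poly_Suc:
  assumes "a > -1"
  shows "(real j + 1) * (real j + a + 1) * coeff (jacobi_poly n a b) (Suc j) =
    (real j - real n) * (real j + real n + a + b + 1) * coeff (jacobi_poly n a b) j"
proof -
  have "pochhammer (a + 1) j > 0" "a + 1 + real j > 0"
    using assms by (auto intro!: pochhammer_pos)
  then show ?thesis
    by (simp add: coeff_jacobi_poly pochhammer_Suc divide_simps) (simp add: algebra_simps)
qed

text \<open>The hypergeometric differential operator, which is the Jacobi operator in the variable
  t.\<close>

definition jacobi_op :: "real \<Rightarrow> real \<Rightarrow> real poly \<Rightarrow> real poly" where
  "jacobi_op a b p = [:0, 1, -1:] * pderiv (pderiv p) + [:a + 1, - (a + b + 2):] * pderiv p"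

lemma coeff_jacobi_op:
  "coeff (jacobi_op a b p) j =
     (real j + 1) * (real j + a + 1) * coeff p (Suc j) - real j * (real j + a + b + 1) * coeff p j"
proof (cases j)
  case 0
  then show ?thesis by (simp add: jacobi_op_def coeff_pderiv)
next
  case (Suc i)
  then show ?thesis
    by (cases i) (auto simp: jacobi_op_def coeff_pderiv algebra_simps)
qed

text \<open>Inserting the two-term recurrence leaves the factor (j-n)(j+n+a+b+1) - j(j+a+b+1), which
  does not depend on j.\<close>

lemma jacobi_op_jacobi_poly:
  assumes "a > -1"
  shows "jacobi_op a b (jacobi_poly n a b) = smult (- real n * (real n + a + b + 1)) (jacobi_poly n a b)"
proof (rule poly_eqI)
  fix j
  have "coeff (jacobi_op a b (jacobi_poly n a b)) j =
    ((real j - real n) * (real j + real n + a + b + 1) - real j * (real j + a + b + 1)) * coeff (jacobi_poly n a b) j"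
    unfolding coeff_jacobi_op coeff_jacobi_poly_Suc[OF assms] by (simp add: algebra_simps)
  also have "\<dots> = - real n * (real n + a + b + 1) * coeff (jacobi_poly n a b) j"
    by (simp add: algebra_simps)
  finally show "coeff (jacobi_op a b (jacobi_poly n a b)) j =
    coeff (smult (- real n * (real n + a + b + 1)) (jacobi_poly n a b)) j" by simp
qed

lemma jacobi_op_monom:
  "jacobi_op a b (monom 1 (Suc m)) = smult (real (Suc m) * (real m + a + 1)) (monom 1 m)
     - smult (real (Suc m) * (real m + a + b + 2)) (monom 1 (Suc m))"
  by (rule poly_eqI) (auto simp: coeff_jacobi_op algebra_simps)

text \<open>The last assumption is the Pearson equation of the weight \<open>t powr a * (1 - t) powr b\<close>.
  It is the only property of the weight that orthogonality needs.\<close>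

locale jacobi_functional =
  fixes a b :: real and L :: "real poly \<Rightarrow> real"
  assumes add: "L (p + q) = L p + L q"
    and smult: "L (smult c p) = c * L p"
    and pearson: "L ([:0, 1, -1:] * pderiv p + [:a + 1, - (a + b + 2):] * p) = 0"
begin

lemma zero: "L 0 = 0" using smult[of 0 0] by simp
lemma diff: "L (p - q) = L p - L q" using add[of p "smult (-1) q"] smult[of "-1" q] by simp
lemma sum: "L (sum f A) = (\<Sum>i\<in>A. L (f i))"
  by (induction A rule: infinite_finite_induct) (simp_all add: zero add)

text \<open>Integration by parts in abstract form: the Pearson equation is applied to p' q. The
  right-hand side is symmetric in p and q, which makes the operator symmetric.\<close>

lemma jacobi_op_eq: "L (jacobi_op a b p * q) = - L ([:0, 1, -1:] * pderiv p * pderiv q)"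
proof -
  have "jacobi_op a b p * q + [:0, 1, -1:] * pderiv p * pderiv q =
    [:0, 1, -1:] * pderiv (pderiv p * q) + [:a + 1, - (a + b + 2):] * (pderiv p * q)"
    unfolding jacobi_op_def pderiv_mult by (simp only: algebra_simps)
  then have "L (jacobi_op a b p * q) + L ([:0, 1, -1:] * pderiv p * pderiv q) = 0"
    by (metis add pearson)
  then show ?thesis by simp
qed

lemma jacobi_op_symmetric: "L (jacobi_op a b p * q) = L (p * jacobi_op a b q)"
  using jacobi_op_eq[of p q] jacobi_op_eq[of q p] by (simp only: mult_ac)

text \<open>By symmetry the operator can act on either factor. On t^(m+1) it gives a multiple of
  t^(m+1) plus a multiple of t^m; the latter drops out by induction, and the two eigenvalues
  differ.\<close>

lemma jacobi_poly_orth_monom: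
  assumes "a > -1" "a + b + 1 \<ge> 0" "m < n"
  shows "L (jacobi_poly n a b * monom 1 m) = 0"
  using \<open>m < n\<close>
proof (induction m)
  case 0
  have "jacobi_op a b (monom 1 0) = 0" by (simp add: jacobi_op_def)
  then have "0 = L (jacobi_op a b (jacobi_poly n a b) * monom 1 0)"
    by (simp only: jacobi_op_symmetric) (simp add: zero)
  also have "\<dots> = - real n * (real n + a + b + 1) * L (jacobi_poly n a b * monom 1 0)"
    by (simp only: jacobi_op_jacobi_poly[OF assms(1)] mult_smult_left smult)
  finally show ?case using 0 assms by auto
next
  case (Suc m)
  have "- real n * (real n + a + b + 1) * L (jacobi_poly n a b * monom 1 (Suc m)) =
      L (jacobi_op a b (jacobi_poly n a b) * monom 1 (Suc m))"
    by (simp only: jacobi_op_jacobi_poly[OF assms(1)] mult_smult_left smult)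
  also have "\<dots> = L (jacobi_poly n a b * jacobi_op a b (monom 1 (Suc m)))"
    by (rule jacobi_op_symmetric)
  also have "\<dots> = - (real (Suc m) * (real m + a + b + 2)) * L (jacobi_poly n a b * monom 1 (Suc m))"
    using Suc by (simp only: jacobi_op_monom right_diff_distrib mult_smult_right diff smult) simp
  \<comment> \<open>The difference of the eigenvalues for degrees n and m + 1, factored;
    \<open>a + b + 1 \<ge> 0\<close> makes the second factor positive.\<close>
  finally have "(real n - real (Suc m)) * (real n + real (Suc m) + a + b + 1) *
      L (jacobi_poly n a b * monom 1 (Suc m)) = 0"
    by (simp add: algebra_simps)
  then show ?case using Suc.prems assms(2) by (auto simp del: of_nat_Suc)
qed

lemma jacobi_poly_orth:
  assumes "a > -1" "a + b + 1 \<ge> 0" "degree p < n"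
  shows "L (jacobi_poly n a b * p) = 0"
proof -
  have "p = (\<Sum>i\<le>degree p. smult (coeff p i) (monom 1 i))"
    by (simp add: smult_monom poly_as_sum_of_monoms)
  then have "L (jacobi_poly n a b * p) = 
      L (jacobi_poly n a b * (\<Sum>i\<le>degree p. smult (coeff p i) (monom 1 i)))" by simp
  also have "\<dots> = (\<Sum>i\<le>degree p. coeff p i * L (jacobi_poly n a b * monom 1 i))"
    by (simp add: sum_distrib_left sum smult del: smult_monom)
  also have "\<dots> = 0"
    using assms by (intro sum.neutral) (auto simp: jacobi_poly_orth_monom)
  finally show ?thesis .
qed

text \<open>Multiplying the weight by t raises a by 1: the new Pearson expression for p, times t, is
  the old one for t p.\<close>

lemma shift_left: "jacobi_functional (a + 1) b (\<lambda>p. L ([:0, 1:] * p))"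
proof
  fix p q c
  show "L ([:0, 1:] * (p + q)) = L ([:0, 1:] * p) + L ([:0, 1:] * q)"
    by (simp only: distrib_left add)
  show "L ([:0, 1:] * smult c p) = c * L ([:0, 1:] * p)"
    by (simp only: mult_smult_right smult)
  have "[:0, 1:] * ([:0, 1, -1:] * pderiv p + [:a + 1 + 1, - (a + 1 + b + 2):] * p) =
    [:0, 1, -1:] * pderiv ([:0, 1:] * p) + [:a + 1, - (a + b + 2):] * ([:0, 1:] * p)"
    by (rule poly_ext) (simp add: pderiv_mult pderiv_pCons pderiv_add pderiv_minus algebra_simps)
  then show "L ([:0, 1:] * ([:0, 1, -1:] * pderiv p + [:a + 1 + 1, - (a + 1 + b + 2):] * p)) = 0"
    by (simp only: pearson)
qed

lemma shift_right: "jacobi_functional a (b + 1) (\<lambda>p. L ([:1, -1:] * p))"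
proof
  fix p q c
  show "L ([:1, -1:] * (p + q)) = L ([:1, -1:] * p) + L ([:1, -1:] * q)"
    by (simp only: distrib_left add)
  show "L ([:1, -1:] * smult c p) = c * L ([:1, -1:] * p)"
    by (simp only: mult_smult_right smult)
  have "[:1, -1:] * ([:0, 1, -1:] * pderiv p + [:a + 1, - (a + (b + 1) + 2):] * p) =
    [:0, 1, -1:] * pderiv ([:1, -1:] * p) + [:a + 1, - (a + b + 2):] * ([:1, -1:] * p)"
    by (rule poly_ext) (simp add: pderiv_mult pderiv_pCons pderiv_add pderiv_minus algebra_simps)
  then show "L ([:1, -1:] * ([:0, 1, -1:] * pderiv p + [:a + 1, - (a + (b + 1) + 2):] * p)) = 0"
    by (simp only: pearson)
qed

end

text \<open>Both sides share the upper parameters -n and n + a + b + 2, so only the Pochhammer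
  symbols of a + 2 and a + 1 differ. At \<open>j = n\<close> the factor is 1, so the leading
  coefficients agree.\<close>

lemma coeff_jacobi_poly_shift:
  assumes "a > -1"
  shows "coeff (jacobi_poly n (a + 1) b) j =
    (a + 1 + real n) / (a + 1 + real j) * coeff (jacobi_poly n a (b + 1)) j"
proof -
  have "pochhammer (a + 1) j > 0" "pochhammer (a + 2) j > 0" "a + 1 + real j > 0" "a + 1 > 0"
    using assms by (auto intro!: pochhammer_pos)
  moreover have "(a + 1) * pochhammer (a + 2) i = (a + 1 + real i) * pochhammer (a + 1) i" for i
    using pochhammer_rec[of "a + 1" i] pochhammer_rec'[of "a + 1" i] by (simp add: algebra_simps)
  from this[of n] this[of j]
  have "pochhammer (a + 2) n = (a + 1 + real n) * pochhammer (a + 1) n / (a + 1)"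
    "pochhammer (a + 2) j = (a + 1 + real j) * pochhammer (a + 1) j / (a + 1)"
    using \<open>a + 1 > 0\<close> by (auto simp: field_simps)
  ultimately show ?thesis
    by (simp add: coeff_jacobi_poly add_ac)
qed

text \<open>Splitting the first factor off (-n-1)_(j+1) and the last one off (n+a+b+2)_(j+1) leaves
  the Pochhammer symbols of degree n with b + 1.\<close>

lemma coeff_jacobi_poly_Suc_degree:
  assumes "a > -1"
  shows "(real j + 1) * (a + 1 + real j) * coeff (jacobi_poly (Suc n) a b) (Suc j) =
    - (a + 1 + real n) * (real n + real j + a + b + 2) * coeff (jacobi_poly n a (b + 1)) j"
proof -
  have pos: "pochhammer (a + 1) j > 0" "a + 1 + real j > 0"
    using assms by (auto intro!: pochhammer_pos)
  have "pochhammer (- real (Suc n)) (Suc j) = - real (Suc n) * pochhammer (- real n) j"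
    by (simp add: pochhammer_rec algebra_simps)
  moreover have "pochhammer (real (Suc n) + a + b + 1) (Suc j) =
     (real n + real j + a + b + 2) * pochhammer (real n + a + (b + 1) + 1) j"
    by (simp add: pochhammer_Suc algebra_simps)
  ultimately have *: "coeff (jacobi_poly (Suc n) a b) (Suc j) =
     pochhammer (a + 1) n * (a + 1 + real n) / (fact n * real (Suc n)) *
     (- real (Suc n) * pochhammer (- real n) j *
       ((real n + real j + a + b + 2) * pochhammer (real n + a + (b + 1) + 1) j) /
       (pochhammer (a + 1) j * (a + 1 + real j) * (fact j * real (Suc j))))"
    unfolding coeff_jacobi_poly by (simp add: pochhammer_Suc mult_ac)
  show ?thesis
    unfolding * using pos by (simp add: coeff_jacobi_poly divide_simps) (intro disjI2, simp add: algebra_simps)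
qed

text \<open>Every coefficient of t^(i+1) is a rational multiple of coefficient i of
  \<open>jacobi_poly n a (b + 1)\<close>, so only an identity of rational functions remains. The
  relation determines the constant c in E(N+1,k).\<close>

lemma jacobi_poly_contiguous:
  assumes "a > -1"
  shows "smult (real n + a + 1) ([:1, -1:] * jacobi_poly n a (b + 1)) -
    smult (real n + b + 1) ([:0, 1:] * jacobi_poly n (a + 1) b) =
    smult (real n + 1) (jacobi_poly (Suc n) a b)"
proof (rule poly_eqI)
  fix j
  show "coeff (smult (real n + a + 1) ([:1, -1:] * jacobi_poly n a (b + 1)) -
    smult (real n + b + 1) ([:0, 1:] * jacobi_poly n (a + 1) b)) j =
    coeff (smult (real n + 1) (jacobi_poly (Suc n) a b)) j"
  proof (cases j)
    case 0
    then show ?thesis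
      by (simp add: coeff_jacobi_poly pochhammer_Suc divide_simps) (simp add: algebra_simps)
  next
    case (Suc i)
    let ?B = "coeff (jacobi_poly n a (b + 1))"
    have nz: "real i + 1 \<noteq> 0" "a + 1 + real i \<noteq> 0" using assms by linarith+
    have B: "?B (Suc i) = (real i - real n) * (real i + real n + a + b + 2) / ((real i + 1) * (a + 1 + real i)) * ?B i"
      using coeff_jacobi_poly_Suc[OF assms, of i n "b + 1"] nz by (simp add: divide_simps) (simp add: algebra_simps)
    have C: "coeff (jacobi_poly (Suc n) a b) (Suc i) = 
        - (a + 1 + real n) * (real n + real i + a + b + 2) / ((real i + 1) * (a + 1 + real i)) * ?B i"
      using coeff_jacobi_poly_Suc_degree[OF assms, of i n b] nz by (simp add: divide_simps) (simp add: algebra_simps)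
    show ?thesis
      using nz by (simp add: Suc B C coeff_jacobi_poly_shift[OF assms] divide_simps) (simp add: algebra_simps)
  qed
qed

section \<open>The weight on the circle\<close>

text \<open>Since \<open>0 powr 0 = 0\<close>, the weight is discontinuous at \<open>\<plusminus>1\<close> when an exponent vanishes; \<open>powr1\<close>
  is the continuous version.\<close>

definition powr1 :: "real \<Rightarrow> real \<Rightarrow> real" where
  "powr1 k x = (if k = 0 then 1 else x powr k)"

definition circle_weight :: "real \<Rightarrow> real \<Rightarrow> real \<Rightarrow> real" where
  "circle_weight k1 k2 \<theta> = powr1 k1 (1 - cos \<theta>) * powr1 k2 (1 - cos (2 * \<theta>))"

lemma continuous_on_powr1:
  assumes "k \<ge> 0" "continuous_on S f" "\<And>x. x \<in> S \<Longrightarrow> f x \<ge> 0"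
  shows "continuous_on S (\<lambda>x. powr1 k (f x))"
  using assms by (cases "k = 0") (auto simp: powr1_def intro!: continuous_intros continuous_on_powr')

lemma continuous_on_circle_weight [continuous_intros]:
  assumes "k1 \<ge> 0" "k2 \<ge> 0"
  shows "continuous_on S (circle_weight k1 k2)"
  unfolding circle_weight_def[abs_def] using assms
  by (intro continuous_intros continuous_on_powr1) auto

lemma circle_weight_nonneg: "circle_weight k1 k2 \<theta> \<ge> 0"
  by (simp add: circle_weight_def powr1_def)

lemma circle_weight_reflect: "circle_weight k1 k2 (2 * pi - \<theta>) = circle_weight k1 k2 \<theta>"
proof -
  have "cos (2 * (2 * pi - \<theta>)) = cos (2 * \<theta>)"
    by (simp only: cos_double cos_2pi_minus sin_2pi_minus) simp
  then show ?thesis by (simp add: circle_weight_def)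
qed

lemma one_minus_cos_double: "1 - cos (2 * \<theta>) = 2 * (sin \<theta>)\<^sup>2" for \<theta> :: real
  by (simp add: cos_double_sin)

lemma one_minus_cos_pos:
  assumes "sin \<theta> \<noteq> 0" shows "1 - cos \<theta> > (0 :: real)"
proof -
  have "cos \<theta> \<noteq> 1" using assms cos_one_sin_zero by blast
  then show ?thesis using cos_le_one[of \<theta>] by linarith
qed

lemma circle_weight_pos: "sin \<theta> \<noteq> 0 \<Longrightarrow> circle_weight k1 k2 \<theta> > 0"
  using one_minus_cos_pos[of \<theta>] unfolding circle_weight_def one_minus_cos_double
  by (auto simp: powr1_def)

lemma sin_eq_0_in_period:
  assumes "\<theta> \<in> {0..2 * pi}" "sin \<theta> = 0" shows "\<theta> \<in> {0, pi, 2 * pi}"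
proof -
  obtain i :: int where i: "\<theta> = of_int i * pi" using assms(2) by (auto simp: sin_zero_iff_int2)
  then have "0 \<le> of_int i * pi" "of_int i * pi \<le> 2 * pi" using assms(1) by auto
  then have "0 \<le> (of_int i :: real)" "(of_int i :: real) \<le> 2"
    by (auto simp: zero_le_mult_iff dest: order.strict_trans2[OF pi_gt_zero])
  then have "i = 0 \<or> i = 1 \<or> i = 2" by linarith
  then show ?thesis using i by auto
qed

text \<open>Away from z = 1 and z = -1 both bases are positive reals, so complex \<open>powr\<close>
  is the real power and \<open>0 powr 0\<close> does not occur.\<close>

lemma delta_weight_cis:
  assumes "sin \<theta> \<noteq> 0"
  shows "delta_weight (k1, k2) (cis \<theta>) = of_real (circle_weight k1 k2 \<theta>)"
proof -
  have "(cis \<theta> + inverse (cis \<theta>)) / 2 = of_real (cos \<theta>)"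
    "((cis \<theta>)\<^sup>2 + inverse ((cis \<theta>)\<^sup>2)) / 2 = of_real (cos (2 * \<theta>))"
    by (simp_all add: complex_eq_iff Complex.DeMoivre)
  moreover have "1 - complex_of_real (cos \<phi>) = of_real (1 - cos \<phi>)" for \<phi> by simp
  moreover have "1 - cos (2 * \<theta>) > 0" using assms by (simp add: one_minus_cos_double)
  ultimately show ?thesis using one_minus_cos_pos[OF assms]
    by (simp add: delta_weight_def powr_of_real circle_weight_def powr1_def del: of_real_diff)
qed

lemma inner_k_eq_integral:
  "inner_k (k1, k2) p q = integral {0..2 * pi}
     (\<lambda>\<theta>. cnj (laurent_eval p (cis \<theta>)) * laurent_eval q (cis \<theta>) * of_real (circle_weight k1 k2 \<theta>))"
proof -
  have "inner_k (k1, k2) p q = integral {0..2 * pi} (\<lambda>\<theta>. cnj (laurent_eval p (cis \<theta>)) *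
      laurent_eval q (cis \<theta>) * delta_weight (k1, k2) (cis \<theta>))"
    unfolding inner_k_def circlepath_def by (simp add: contour_integral_part_circlepath_eq)
  also have "\<dots> = integral {0..2 * pi}
     (\<lambda>\<theta>. cnj (laurent_eval p (cis \<theta>)) * laurent_eval q (cis \<theta>) * of_real (circle_weight k1 k2 \<theta>))"
  \<comment> \<open>The two weights can differ only at 0, pi and 2 pi, a null set.\<close>
  proof (rule integral_spike)
    show "negligible {0, pi, 2 * pi}" by simp
  qed (use sin_eq_0_in_period delta_weight_cis in fastforce)
  finally show ?thesis .
qed

section \<open>Integrals over the circle and their Pearson equation\<close>

lemma integral_reflect_period: "integral {0..2 * pi} (\<lambda>\<theta>. h (2 * pi - \<theta>)) = integral {0..2 * pi} h"
  for h :: "real \<Rightarrow> 'a :: euclidean_space"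
  using integral_shift_real_ivl[of 0 "2 * pi" "2 * pi" h]
    Henstock_Kurzweil_Integration.integral_reflect_real[of 0 "-(2 * pi)"  "\<lambda>x. h (x + 2 * pi)"]
  by simp

text \<open>The reflection makes the integral equal to its own conjugate; this is the cancellation
  of the part that is odd under z -> 1/z.\<close>

lemma integral_eq_integral_Re:
  assumes "continuous_on {0..2 * pi} h" "\<And>\<theta>. h (2 * pi - \<theta>) = cnj (h \<theta>)"
  shows "integral {0..2 * pi} h = of_real (integral {0..2 * pi} (\<lambda>\<theta>. Re (h \<theta>)))"
proof -
  have "cnj (integral {0..2 * pi} h) = integral {0..2 * pi} h"
    using integral_reflect_period[of h] assms(2) by (simp add: integral_cnj)
  then have "integral {0..2 * pi} h = of_real (Re (integral {0..2 * pi} h))"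
    by (simp add: complex_eq_iff)
  also have "Re (integral {0..2 * pi} h) = integral {0..2 * pi} (\<lambda>\<theta>. Re (h \<theta>))"
    using integral_linear[OF integrable_continuous_real[OF assms(1)] bounded_linear_Re]
    by (simp add: o_def)
  finally show ?thesis .
qed

text \<open>The functional L of the overview. With 1 - cos \<theta> = 2t and 1 - cos 2\<theta> =
  8t(1-t) it is, up to a constant, the integral over [0,1] against t^\<alpha> (1-t)^\<beta>; on the
  circle the weight stays continuous for nonnegative exponents.\<close>

definition circle_int :: "real \<Rightarrow> real \<Rightarrow> real poly \<Rightarrow> real" where
  "circle_int k1 k2 p = integral {0..2 * pi} (\<lambda>\<theta>. poly p ((1 - cos \<theta>) / 2) * circle_weight k1 k2 \<theta>)"

lemma powr1_has_derivative:
  assumes "x > 0" shows "(powr1 k has_real_derivative k * powr1 k x / x) (at x)"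
proof (cases "k = 0")
  case True
  then show ?thesis by (simp add: powr1_def[abs_def])
next
  case False
  then show ?thesis using assms unfolding powr1_def[abs_def]
    by (auto intro!: derivative_eq_intros simp: powr_diff)
qed

text \<open>The logarithmic derivative is brought over the denominator sin \<theta>, so that the
  factor sin \<theta> of the primitive for the Pearson equation cancels it.\<close>

lemma circle_weight_has_derivative:
  assumes "sin \<theta> \<noteq> 0"
  shows "(circle_weight k1 k2 has_real_derivative
    (k1 * (1 + cos \<theta>) + 2 * k2 * cos \<theta>) / sin \<theta> * circle_weight k1 k2 \<theta>) (at \<theta>)"
proof -
  have pos: "1 - cos \<theta> > 0" "1 - cos (2 * \<theta>) > 0"
    using one_minus_cos_pos[OF assms] assms by (simp_all add: one_minus_cos_double)
  have "((\<lambda>\<theta>. 1 - cos \<theta>) has_real_derivative sin \<theta>) (at \<theta>)"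
    "((\<lambda>\<theta>. 1 - cos (2 * \<theta>)) has_real_derivative 2 * sin (2 * \<theta>)) (at \<theta>)"
    by (auto intro!: derivative_eq_intros)
  from this[THEN DERIV_chain2[rotated]] pos[THEN powr1_has_derivative]
  have "((\<lambda>\<theta>. powr1 k1 (1 - cos \<theta>)) has_real_derivative
      k1 * powr1 k1 (1 - cos \<theta>) / (1 - cos \<theta>) * sin \<theta>) (at \<theta>)"
    "((\<lambda>\<theta>. powr1 k2 (1 - cos (2 * \<theta>))) has_real_derivative
      k2 * powr1 k2 (1 - cos (2 * \<theta>)) / (1 - cos (2 * \<theta>)) * (2 * sin (2 * \<theta>))) (at \<theta>)"
    by blast+
  from DERIV_mult[OF this] have "(circle_weight k1 k2 has_real_derivative
     (k1 * (sin \<theta> / (1 - cos \<theta>)) + k2 * (2 * sin (2 * \<theta>) / (1 - cos (2 * \<theta>))))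
       * circle_weight k1 k2 \<theta>) (at \<theta>)"
    unfolding circle_weight_def[abs_def] by (simp add: algebra_simps)
  moreover have "sin \<theta> / (1 - cos \<theta>) = (1 + cos \<theta>) / sin \<theta>"
    using pos assms sin_cos_squared_add[of \<theta>] by (simp add: divide_simps power2_eq_square algebra_simps)
  moreover have "2 * sin (2 * \<theta>) / (1 - cos (2 * \<theta>)) = 2 * cos \<theta> / sin \<theta>"
    using assms by (simp add: one_minus_cos_double sin_double power2_eq_square)
  moreover have "k1 * ((1 + cos \<theta>) / sin \<theta>) + k2 * (2 * cos \<theta> / sin \<theta>) =
      (k1 * (1 + cos \<theta>) + 2 * k2 * cos \<theta>) / sin \<theta>"
    by (simp add: add_divide_distrib distrib_left)
  ultimately show ?thesis by (simp only:)
qed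

lemma circle_int_integrable:
  assumes "k1 \<ge> 0" "k2 \<ge> 0"
  shows "(\<lambda>\<theta>. poly p ((1 - cos \<theta>) / 2) * circle_weight k1 k2 \<theta>) integrable_on {0..2 * pi}"
  using assms by (intro integrable_continuous_real continuous_intros) auto

text \<open>The Pearson integrand is the derivative of a function that vanishes at 0 and 2
  pi.\<close>

lemma jacobi_functional_circle_int:
  assumes "k1 \<ge> 0" "k2 \<ge> 0"
  shows "jacobi_functional (k1 + k2 - 1/2) (k2 - 1/2) (circle_int k1 k2)"
proof
  note int = circle_int_integrable[OF assms]
  fix p q c
  show "circle_int k1 k2 (p + q) = circle_int k1 k2 p + circle_int k1 k2 q"
    unfolding circle_int_def poly_add distrib_right by (rule integral_add[OF int int])
  show "circle_int k1 k2 (smult c p) = c * circle_int k1 k2 p"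
    unfolding circle_int_def poly_smult mult.assoc by simp
  let ?P = "[:0, 1, -1:] * pderiv p + [:k1 + k2 - 1/2 + 1, - (k1 + k2 - 1/2 + (k2 - 1/2) + 2):] * p"
  let ?f = "\<lambda>\<theta>. poly ?P ((1 - cos \<theta>) / 2) * circle_weight k1 k2 \<theta>"
  \<comment> \<open>Since sin \<theta> / 2 is the square root of t(1-t) on [0, pi], this is there,
    up to a constant, t(1-t) p times the Jacobi weight in t: the usual boundary term.\<close>
  let ?F = "\<lambda>\<theta>. 1/2 * sin \<theta> * (poly p ((1 - cos \<theta>) / 2) * circle_weight k1 k2 \<theta>)"
  have "(?f has_integral (?F (2 * pi) - ?F 0)) {0..2 * pi}"
  \<comment> \<open>This version asks for the derivative only off a finite set; at multiples of pi
    small exponents may destroy differentiability of the weight.\<close>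
  proof (rule fundamental_theorem_of_calculus_strong)
    show "finite {0, pi, 2 * pi}" by simp
    show "continuous_on {0..2 * pi} ?F" using assms by (intro continuous_intros) auto
    fix \<theta> assume "\<theta> \<in> {0..2 * pi} - {0, pi, 2 * pi}"
    then have s: "sin \<theta> \<noteq> 0" using sin_eq_0_in_period by blast
    have "(?F has_real_derivative
      1/2 * cos \<theta> * (poly p ((1 - cos \<theta>) / 2) * circle_weight k1 k2 \<theta>) +
      1/2 * sin \<theta> * (poly (pderiv p) ((1 - cos \<theta>) / 2) * (sin \<theta> / 2) * circle_weight k1 k2 \<theta> +
         poly p ((1 - cos \<theta>) / 2) * ((k1 * (1 + cos \<theta>) + 2 * k2 * cos \<theta>) / sin \<theta> * circle_weight k1 k2 \<theta>))) (at \<theta>)"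
      using s by (auto intro!: derivative_eq_intros circle_weight_has_derivative
          DERIV_chain2[OF poly_DERIV] simp: algebra_simps)
    also have "1/2 * cos \<theta> * (poly p ((1 - cos \<theta>) / 2) * circle_weight k1 k2 \<theta>) +
      1/2 * sin \<theta> * (poly (pderiv p) ((1 - cos \<theta>) / 2) * (sin \<theta> / 2) * circle_weight k1 k2 \<theta> +
         poly p ((1 - cos \<theta>) / 2) * ((k1 * (1 + cos \<theta>) + 2 * k2 * cos \<theta>) / sin \<theta> * circle_weight k1 k2 \<theta>))
      = ((sin \<theta>)\<^sup>2 / 4 * poly (pderiv p) ((1 - cos \<theta>) / 2) +
         1/2 * (cos \<theta> + k1 * (1 + cos \<theta>) + 2 * k2 * cos \<theta>) * poly p ((1 - cos \<theta>) / 2)) * circle_weight k1 k2 \<theta>"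
      using s by (simp add: field_simps power2_eq_square)
    also have "\<dots> = ?f \<theta>"
      unfolding sin_squared_eq by (simp add: field_simps power2_eq_square)
    finally show "(?F has_vector_derivative ?f \<theta>) (at \<theta>)"
      by (simp only: has_real_derivative_iff_has_vector_derivative)
  qed simp
  then show "circle_int k1 k2 ?P = 0"
    unfolding circle_int_def by (simp add: integral_unique)
qed

section \<open>Laurent polynomials\<close>

text \<open>Only the exponent window is recorded, for functions on nonzero z, so that sums,
  multiples and shifts can be handled pointwise without computing coefficients.\<close>

definition laurent_span :: "int \<Rightarrow> int \<Rightarrow> (complex \<Rightarrow> complex) \<Rightarrow> bool" where
  "laurent_span l u f \<longleftrightarrow> (\<exists>a. \<forall>z. z \<noteq> 0 \<longrightarrow> f z = (\<Sum>j=l..u. a j * z powi j))"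

lemma laurent_span_cong:
  "laurent_span l u f \<Longrightarrow> (\<And>z. z \<noteq> 0 \<Longrightarrow> f z = g z) \<Longrightarrow> laurent_span l u g"
  unfolding laurent_span_def by metis

lemma laurent_span_mono:
  assumes "laurent_span l u f" "l' \<le> l" "u \<le> u'"
  shows "laurent_span l' u' f"
proof -
  from assms(1) obtain a where a: "\<And>z. z \<noteq> 0 \<Longrightarrow> f z = (\<Sum>j=l..u. a j * z powi j)"
    unfolding laurent_span_def by blast
  have "f z = (\<Sum>j=l'..u'. (if j \<in> {l..u} then a j else 0) * z powi j)" if "z \<noteq> 0" for z
    unfolding a[OF that] using assms by (intro sum.mono_neutral_cong_left) auto
  then show ?thesis unfolding laurent_span_def by metis
qed

lemma laurent_span_add:
  assumes "laurent_span l u f" "laurent_span l u g"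
  shows "laurent_span l u (\<lambda>z. f z + g z)"
proof -
  from assms obtain a b where "\<And>z. z \<noteq> 0 \<Longrightarrow> f z = (\<Sum>j=l..u. a j * z powi j)"
    "\<And>z. z \<noteq> 0 \<Longrightarrow> g z = (\<Sum>j=l..u. b j * z powi j)"
    unfolding laurent_span_def by blast
  then have "\<forall>z. z \<noteq> 0 \<longrightarrow> f z + g z = (\<Sum>j=l..u. (a j + b j) * z powi j)"
    by (simp add: sum.distrib algebra_simps)
  then show ?thesis unfolding laurent_span_def by (intro exI[of _ "\<lambda>j. a j + b j"])
qed

lemma laurent_span_cmult:
  assumes "laurent_span l u f"
  shows "laurent_span l u (\<lambda>z. c * f z)"
proof -
  from assms obtain a where "\<And>z. z \<noteq> 0 \<Longrightarrow> f z = (\<Sum>j=l..u. a j * z powi j)"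
    unfolding laurent_span_def by blast
  then have "\<forall>z. z \<noteq> 0 \<longrightarrow> c * f z = (\<Sum>j=l..u. (c * a j) * z powi j)"
    by (simp add: sum_distrib_left mult_ac)
  then show ?thesis unfolding laurent_span_def by (intro exI[of _ "\<lambda>j. c * a j"])
qed

lemma laurent_span_diff:
  "laurent_span l u f \<Longrightarrow> laurent_span l u g \<Longrightarrow> laurent_span l u (\<lambda>z. f z - g z)"
  using laurent_span_add[of l u f "\<lambda>z. (-1) * g z"] laurent_span_cmult[of l u g "-1"] by simp

lemma laurent_span_zero: "laurent_span l u (\<lambda>z. 0)"
  unfolding laurent_span_def by (rule exI[of _ "\<lambda>_. 0"]) simp

lemma laurent_span_sum:
  "(\<And>i. i \<in> I \<Longrightarrow> laurent_span l u (f i)) \<Longrightarrow> laurent_span l u (\<lambda>z. \<Sum>i\<in>I. f i z)"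
  by (induction I rule: infinite_finite_induct) (auto simp: laurent_span_zero intro!: laurent_span_add)

lemma laurent_span_powi:
  assumes "l \<le> i" "i \<le> u"
  shows "laurent_span l u (\<lambda>z. z powi i)"
proof -
  have "z powi i = (\<Sum>j=l..u. (if j = i then 1 else 0) * z powi j)" for z :: complex
    using assms by (simp add: if_distrib[of "\<lambda>x. x * _"] cong: if_cong)
  then show ?thesis unfolding laurent_span_def by metis
qed

lemma laurent_span_shift:
  assumes "laurent_span l u f"
  shows "laurent_span (l + i) (u + i) (\<lambda>z. z powi i * f z)"
proof -
  from assms obtain a where a: "\<And>z. z \<noteq> 0 \<Longrightarrow> f z = (\<Sum>j=l..u. a j * z powi j)"
    unfolding laurent_span_def by blast
  have "z powi i * f z = (\<Sum>j=l+i..u+i. a (j - i) * z powi j)" if "z \<noteq> 0" for z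
    unfolding a[OF that] sum_distrib_left
    by (rule sum.reindex_bij_witness[of _ "\<lambda>j. j - i" "\<lambda>j. j + i"])
       (use that in \<open>auto simp: power_int_add mult_ac\<close>)
  then show ?thesis unfolding laurent_span_def by (intro exI allI impI)
qed

lemma laurent_span_inverse:
  assumes "laurent_span l u f"
  shows "laurent_span (- u) (- l) (\<lambda>z. f (inverse z))"
proof -
  from assms obtain a where a: "\<And>z. z \<noteq> 0 \<Longrightarrow> f z = (\<Sum>j=l..u. a j * z powi j)"
    unfolding laurent_span_def by blast
  have "f (inverse z) = (\<Sum>j=-u..-l. a (- j) * z powi j)" if "z \<noteq> 0" for z
  proof -
    have "f (inverse z) = (\<Sum>j=l..u. a j * inverse z powi j)" using a that by simp
    also have "\<dots> = (\<Sum>j=-u..-l. a (- j) * z powi j)"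
      by (rule sum.reindex_bij_witness[of _ uminus uminus])
         (auto simp: power_int_minus power_int_inverse)
    finally show ?thesis .
  qed
  then show ?thesis unfolding laurent_span_def by (intro exI allI impI)
qed

section \<open>Powers of t as Laurent polynomials in z\<close>

definition jacobi_var :: "complex \<Rightarrow> complex" where
  "jacobi_var z = (1 - (z + inverse z) / 2) / 2"

text \<open>As t = 1/2 - z/4 - 1/(4z), the term z^(-m) of t^m arises only by taking -1/(4z) from
  each factor.\<close>

lemma jacobi_var_power_lowest:
  "laurent_span (1 - int m) (int m) (\<lambda>z. jacobi_var z ^ m - (-1/4) ^ m * z powi (- int m))"
proof (induction m)
  case 0
  show ?case by (rule laurent_span_cong[OF laurent_span_zero]) simp
next
  case (Suc m)
  let ?g = "\<lambda>z. jacobi_var z ^ m - (-1/4) ^ m * z powi (- int m)"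
  \<comment> \<open>The new difference is t times the old one plus t (-1/4)^m z^(-m) with its lowest
    term removed; each product with t is split into its summands.\<close>
  have "laurent_span (- int m) (int m + 1) (\<lambda>z. 1/2 * ?g z + (-1/4) * (z powi 1 * ?g z) + (-1/4) * (z powi (-1) * ?g z)
    + (1/2 * (-1/4) ^ m) * z powi (- int m) + (-1/4) ^ Suc m * z powi (1 - int m))"
    by (intro laurent_span_add laurent_span_cmult laurent_span_powi
       laurent_span_mono[OF Suc] laurent_span_mono[OF laurent_span_shift[OF Suc]]) auto
  then have "laurent_span (- int m) (int m + 1)
      (\<lambda>z. jacobi_var z ^ Suc m - (-1/4) ^ Suc m * z powi (- int (Suc m)))"
  proof (rule laurent_span_cong)
    fix z :: complex assume z: "z \<noteq> 0"
    have p: "z powi (1 - int m) = z * z powi (- int m)"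
      "z powi (- int (Suc m)) = inverse z * z powi (- int m)"
      using z power_int_add[of z 1 "- int m"] power_int_add[of z "-1" "- int m"] by (simp_all add: power_int_minus)
    have v: "jacobi_var z = 1/2 - z / 4 - inverse z / 4"
      by (simp add: jacobi_var_def field_simps)
    show "1/2 * ?g z + (-1/4) * (z powi 1 * ?g z) + (-1/4) * (z powi (-1) * ?g z)
      + (1/2 * (-1/4) ^ m) * z powi (- int m) + (-1/4) ^ Suc m * z powi (1 - int m)
      = jacobi_var z ^ Suc m - (-1/4) ^ Suc m * z powi (- int (Suc m))"
      unfolding p power_Suc by (simp add: v power_int_minus algebra_simps)
  qed
  then show ?case by (simp add: add.commute)
qed

text \<open>\<open>jacobi_var\<close> is invariant under z -> 1/z, which exchanges the two ends of
  the window.\<close>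

lemma jacobi_var_power_highest:
  "laurent_span (- int m) (int m - 1) (\<lambda>z. jacobi_var z ^ m - (-1/4) ^ m * z powi int m)"
proof -
  have "laurent_span (- int m) (- (1 - int m))
     (\<lambda>z. jacobi_var (inverse z) ^ m - (-1/4) ^ m * inverse z powi (- int m))"
    by (rule laurent_span_inverse[OF jacobi_var_power_lowest])
  then show ?thesis
    by (simp add: jacobi_var_def power_int_minus power_int_inverse power_inverse add.commute)
qed

lemma jacobi_var_power: "laurent_span (- int m) (int m) (\<lambda>z. jacobi_var z ^ m)"
proof -
  have "laurent_span (- int m) (int m)
     (\<lambda>z. (jacobi_var z ^ m - (-1/4) ^ m * z powi (- int m)) + (-1/4) ^ m * z powi (- int m))"
    by (intro laurent_span_add laurent_span_cmult laurent_span_powi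
         laurent_span_mono[OF jacobi_var_power_lowest]) auto
  then show ?thesis by simp
qed

lemma jacobi_var_lessThan_sum:
  assumes "l \<le> 1 - int n" "int n - 1 \<le> u"
  shows "laurent_span l u (\<lambda>z. \<Sum>j<n. a j * jacobi_var z ^ j)"
  by (intro laurent_span_sum laurent_span_cmult laurent_span_mono[OF jacobi_var_power])
     (use assms in auto)

text \<open>The factor (-n)_j cuts the hypergeometric series off after j = n, so
  \<open>eval_fps\<close> is a finite sum.\<close>

lemma jacobi_P_eq_sum:
  "jacobi_P n a b x = (\<Sum>j\<le>n. of_real (coeff (jacobi_poly n a b) j) * ((1 - x) / 2) ^ j)"
proof -
  let ?F = "fps_hypergeo [- of_nat n, of_nat n + of_real a + of_real b + 1] [of_real a + 1] (1 :: complex)"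
  have "pochhammer (of_nat n + of_real a + of_real b + 1) j =
      complex_of_real (pochhammer (real n + a + b + 1) j)"
    "pochhammer (of_real a + 1) j = complex_of_real (pochhammer (a + 1) j)"
    "pochhammer (- of_nat n) j = complex_of_real (pochhammer (- real n) j)" for j
    by (simp_all flip: pochhammer_of_real)
  then have F: "fps_nth ?F j = of_real (pochhammer (- real n) j * pochhammer (real n + a + b + 1) j /
       (pochhammer (a + 1) j * fact j))" for j
    by simp
  have "hypergeo_2F1 (- of_nat n) (of_nat n + of_real a + of_real b + 1) (of_real a + 1) w =
     (\<Sum>j\<le>n. fps_nth ?F j * w ^ j)" for w
    unfolding hypergeo_2F1_def eval_fps_def
    by (rule suminf_finite) (auto simp: F pochhammer_of_nat_eq_0_iff simp del: fps_hypergeo_nth)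
  then show ?thesis
    unfolding jacobi_P_def F coeff_jacobi_poly by (simp add: sum_distrib_left mult.assoc)
qed

section \<open>Laurent polynomials as finitely supported maps\<close>

lemma laurent_eval_superset:
  assumes "finite J" "Poly_Mapping.keys p \<subseteq> J"
  shows "laurent_eval p z = (\<Sum>j\<in>J. Poly_Mapping.lookup p j * z powi j)"
  unfolding laurent_eval_def using assms
  by (intro sum.mono_neutral_left) (auto simp: in_keys_iff)

lemma laurent_eval_add: "laurent_eval (p + q) z = laurent_eval p z + laurent_eval q z"
proof -
  let ?J = "Poly_Mapping.keys p \<union> Poly_Mapping.keys q"
  have "finite ?J" "Poly_Mapping.keys (p + q) \<subseteq> ?J" by (simp_all add: keys_add)
  then show ?thesis
    by (simp add: laurent_eval_superset[of ?J] lookup_add sum.distrib algebra_simps)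
qed

lemma laurent_eval_diff: "laurent_eval (p - q) z = laurent_eval p z - laurent_eval q z"
  using laurent_eval_add[of "p - q" q z] by simp

lemma laurent_eval_monom [simp]: "laurent_eval (laurent_monom j) z = z powi j"
  by (simp add: laurent_eval_def laurent_monom_def)

lemma laurent_span_imp_laurent_poly:
  assumes "laurent_span l u f"
  obtains q where "Poly_Mapping.keys q \<subseteq> {l..u}" "\<And>z. z \<noteq> 0 \<Longrightarrow> laurent_eval q z = f z"
proof -
  from assms obtain a where a: "\<And>z. z \<noteq> 0 \<Longrightarrow> f z = (\<Sum>j=l..u. a j * z powi j)"
    unfolding laurent_span_def by blast
  define q where "q = (\<Sum>j=l..u. Poly_Mapping.single j (a j))"
  have l: "Poly_Mapping.lookup q i = (if i \<in> {l..u} then a i else 0)" for i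
    by (simp add: q_def lookup_sum lookup_single when_def)
  then have k: "Poly_Mapping.keys q \<subseteq> {l..u}" by (auto simp: in_keys_iff split: if_splits)
  show thesis
    by (rule that[OF k]) (simp add: laurent_eval_superset[OF _ k] a l)
qed

lemma continuous_on_laurent_eval_cis [continuous_intros]:
  "continuous_on S (\<lambda>\<theta>. laurent_eval p (cis \<theta>))"
  unfolding laurent_eval_def by (intro continuous_intros continuous_on_power_int) auto

text \<open>Multiplying by a power of z gives an ordinary polynomial with infinitely many zeros on
  the open upper half circle. Points with sin \<theta> = 0 are left out because the weight may
  vanish there.\<close>

lemma laurent_eval_cis_eq_0_imp_0:
  assumes "\<And>\<theta>. \<theta> \<in> {0..2 * pi} \<Longrightarrow> laurent_eval p (cis \<theta>) = 0 \<or> sin \<theta> = 0"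
  shows "p = 0"
proof -
  \<comment> \<open>A bound for the absolute values of all exponents; as a sum it also makes sense
    for \<open>p = 0\<close>.\<close>
  define M where "M = (\<Sum>j\<in>Poly_Mapping.keys p. nat \<bar>j\<bar>)"
  have M: "- int M \<le> j" if "j \<in> Poly_Mapping.keys p" for j
  proof -
    have "nat \<bar>j\<bar> \<le> M" unfolding M_def by (rule member_le_sum) (use that in auto)
    then show ?thesis by linarith
  qed
  define P where "P = (\<Sum>j\<in>Poly_Mapping.keys p. monom (Poly_Mapping.lookup p j) (nat (j + int M)))"
  have P: "poly P z = z ^ M * laurent_eval p z" if "z \<noteq> 0" for z
  proof -
    have "z ^ nat (j + int M) = z ^ M * z powi j" if "j \<in> Poly_Mapping.keys p" for j
      using M[OF that] \<open>z \<noteq> 0\<close> power_int_add[of z j "int M"] by (simp add: power_int_def mult_ac)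
    then show ?thesis
      by (simp add: P_def poly_sum poly_monom laurent_eval_def sum_distrib_left mult_ac)
  qed
  have "cis ` {0<..<pi} \<subseteq> {z. poly P z = 0}"
  proof safe
    fix \<theta> :: real assume "\<theta> \<in> {0<..<pi}"
    then have "\<theta> \<in> {0..2 * pi}" "sin \<theta> \<noteq> 0" using sin_gt_zero[of \<theta>] by auto
    then show "poly P (cis \<theta>) = 0" using P[of "cis \<theta>"] assms[of \<theta>] by simp
  qed
  moreover have "inj_on cis {0<..<pi}"
  proof (rule inj_onI)
    fix x y assume "x \<in> {0<..<pi}" "y \<in> {0<..<pi}" "cis x = cis y"
    then show "x = y" using cos_inj_pi[of x y] by (auto simp: complex_eq_iff)
  qed
  then have "infinite (cis ` {0<..<pi})" by (simp add: finite_image_iff)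
  ultimately have "P = 0" using poly_roots_finite finite_subset by blast
  have "Poly_Mapping.lookup p i = 0" for i
  proof (rule ccontr)
    assume "Poly_Mapping.lookup p i \<noteq> 0"
    then have i: "i \<in> Poly_Mapping.keys p" by (simp add: in_keys_iff)
    have "nat (j + int M) = nat (i + int M) \<longleftrightarrow> j = i" if "j \<in> Poly_Mapping.keys p" for j
      using M[OF that] M[OF i] by auto
    then have "coeff P (nat (i + int M)) = (\<Sum>j\<in>Poly_Mapping.keys p. if j = i then Poly_Mapping.lookup p j else 0)"
      unfolding P_def coeff_sum by (intro sum.cong) auto
    then show False using i \<open>P = 0\<close> by (simp add: in_keys_iff)
  qed
  then show ?thesis by (intro poly_mapping_eqI) simp
qed

section \<open>Definiteness of the inner product and uniqueness of E(n,k)\<close>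

lemma inner_k_diff_left:
  assumes "k1 \<ge> 0" "k2 \<ge> 0"
  shows "inner_k (k1, k2) (p - q) r = inner_k (k1, k2) p r - inner_k (k1, k2) q r"
  unfolding inner_k_eq_integral laurent_eval_diff complex_cnj_diff left_diff_distrib
  by (intro integral_diff integrable_continuous_real continuous_intros) (use assms in auto)

lemma inner_k_expand_right:
  assumes "k1 \<ge> 0" "k2 \<ge> 0"
  shows "inner_k (k1, k2) p q =
    (\<Sum>j\<in>Poly_Mapping.keys q. Poly_Mapping.lookup q j * inner_k (k1, k2) p (laurent_monom j))"
proof -
  let ?h = "\<lambda>j \<theta>. cnj (laurent_eval p (cis \<theta>)) * laurent_eval (laurent_monom j) (cis \<theta>) *
    complex_of_real (circle_weight k1 k2 \<theta>)"
  have "inner_k (k1, k2) p q = integral {0..2 * pi}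
      (\<lambda>\<theta>. \<Sum>j\<in>Poly_Mapping.keys q. Poly_Mapping.lookup q j * ?h j \<theta>)"
    unfolding inner_k_eq_integral laurent_eval_def[of q]
    by (simp add: sum_distrib_left sum_distrib_right mult_ac)
  also have "\<dots> = (\<Sum>j\<in>Poly_Mapping.keys q. integral {0..2 * pi} (\<lambda>\<theta>. Poly_Mapping.lookup q j * ?h j \<theta>))"
    by (intro integral_sum integrable_continuous_real continuous_intros) (use assms in auto)
  finally show ?thesis by (simp add: inner_k_eq_integral)
qed

text \<open>The integrand |p|^2 times the weight is continuous and nonnegative, so it vanishes
  identically, while the weight is positive where sin \<theta> is nonzero.\<close>

lemma inner_k_self_eq_0:
  assumes "k1 \<ge> 0" "k2 \<ge> 0" "inner_k (k1, k2) p p = 0"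
  shows "p = 0"
proof (rule laurent_eval_cis_eq_0_imp_0)
  let ?f = "\<lambda>\<theta>. (cmod (laurent_eval p (cis \<theta>)))\<^sup>2 * circle_weight k1 k2 \<theta>"
  have cont: "continuous_on {0..2 * pi} ?f" using assms by (intro continuous_intros) auto
  have "inner_k (k1, k2) p p = integral {0..2 * pi} (\<lambda>\<theta>. of_real (?f \<theta>))"
    unfolding inner_k_eq_integral
    by (simp only: of_real_mult complex_norm_square mult.commute)
  also have "\<dots> = of_real (integral {0..2 * pi} ?f)"
    by (intro integral_unique has_integral_of_real integrable_integral integrable_continuous_real cont)
  finally have "(?f has_integral 0) {0..2 * pi}"
    using assms(3) integrable_integral[OF integrable_continuous_real[OF cont]] by simp
  fix \<theta> :: real assume "\<theta> \<in> {0..2 * pi}"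
  have "?f \<theta> = 0"
  proof (rule has_integral_0_cbox_imp_0[of 0 "2 * pi" ?f])
    show "box 0 (2 * pi) \<noteq> {}" by (simp add: box_ne_empty not_le)
  qed (use cont \<open>(?f has_integral 0) {0..2 * pi}\<close> \<open>\<theta> \<in> _\<close> in \<open>auto simp: circle_weight_nonneg\<close>)
  then show "laurent_eval p (cis \<theta>) = 0 \<or> sin \<theta> = 0"
    using circle_weight_pos[of \<theta> k1 k2] by auto
qed

text \<open>The difference of two candidates has only monomials below z^n, and it is orthogonal to
  all of those, hence to itself.\<close>

lemma nonsym_jacobi_E_eqI:
  assumes "k1 \<ge> 0" "k2 \<ge> 0" "is_nonsym_jacobi n (k1, k2) p"
  shows "nonsym_jacobi_E n (k1, k2) = p"
  unfolding nonsym_jacobi_E_def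
proof (rule the_equality)
  fix p' assume "is_nonsym_jacobi n (k1, k2) p'"
  with assms(3) obtain q q' where *: "p = laurent_monom n + q" "p' = laurent_monom n + q'"
     "\<forall>j\<in>Poly_Mapping.keys q. monom_less j n" "\<forall>j\<in>Poly_Mapping.keys q'. monom_less j n"
    and orth: "\<And>j. monom_less j n \<Longrightarrow> inner_k (k1, k2) p (laurent_monom j) = 0"
     "\<And>j. monom_less j n \<Longrightarrow> inner_k (k1, k2) p' (laurent_monom j) = 0"
    unfolding is_nonsym_jacobi_def by blast
  have "monom_less j n" if "j \<in> Poly_Mapping.keys (p' - p)" for j
    using that keys_diff[of q' q] *(3,4) by (auto simp: *(1,2))
  then have "inner_k (k1, k2) (p' - p) (p' - p) = 0"
    using assms orth by (subst inner_k_expand_right) (simp_all add: inner_k_diff_left)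
  then have "p' - p = 0" using inner_k_self_eq_0 assms by blast
  then show "p' = p" by simp
qed fact

section \<open>Reduction of the inner product to L\<close>

lemma poly_atMost_sum:
  fixes p :: "real poly"
  assumes "degree p \<le> n" shows "poly p x = (\<Sum>j\<le>n. coeff p j * x ^ j)"
  unfolding poly_altdef by (rule sum.mono_neutral_left) (use assms in \<open>auto simp: coeff_eq_0\<close>)

lemma cis_reflect: "cis (2 * pi - \<theta>) = cnj (cis \<theta>)"
  by (simp add: complex_eq_iff)

text \<open>All data are real, so the integrand is conjugated by z -> 1/z and only its real part
  counts. On the circle Re(1-z) = 2t and Re(1+z) = 2(1-t), while cnj(1-z) z = -(1-z) and cnj(1+z) z
  = 1+z; hence the opposite sign of \<open>u\<close> in the factor of \<open>q\<close>.\<close>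

lemma inner_k_eq_circle_int:
  assumes "k1 \<ge> 0" "k2 \<ge> 0"
    and P: "\<And>\<theta>. laurent_eval P (cis \<theta>) =
       of_real u * (1 - cis \<theta>) * of_real (poly A ((1 - cos \<theta>) / 2)) +
       of_real v * (1 + cis \<theta>) * of_real (poly B ((1 - cos \<theta>) / 2))"
    and Q: "\<And>\<theta>. laurent_eval Q (cis \<theta>) =
       of_real (poly p ((1 - cos \<theta>) / 2)) + cis \<theta> * of_real (poly q ((1 - cos \<theta>) / 2))"
  shows "inner_k (k1, k2) P Q = of_real (circle_int k1 k2 (smult 2
    ((smult v ([:1, -1:] * B) + smult u ([:0, 1:] * A)) * p +
     (smult v ([:1, -1:] * B) - smult u ([:0, 1:] * A)) * q)))"
proof -
  let ?h = "\<lambda>\<theta>. cnj (laurent_eval P (cis \<theta>)) * laurent_eval Q (cis \<theta>) * of_real (circle_weight k1 k2 \<theta>)"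
  have "inner_k (k1, k2) P Q = of_real (integral {0..2 * pi} (\<lambda>\<theta>. Re (?h \<theta>)))"
    unfolding inner_k_eq_integral
  proof (rule integral_eq_integral_Re)
    show "continuous_on {0..2 * pi} ?h" using assms by (intro continuous_intros) auto
    show "?h (2 * pi - \<theta>) = cnj (?h \<theta>)" for \<theta>
      unfolding P Q unfolding cis_reflect circle_weight_reflect by simp
  qed
  also have "(\<lambda>\<theta>. Re (?h \<theta>)) = (\<lambda>\<theta>. poly (smult 2
    ((smult v ([:1, -1:] * B) + smult u ([:0, 1:] * A)) * p +
     (smult v ([:1, -1:] * B) - smult u ([:0, 1:] * A)) * q)) ((1 - cos \<theta>) / 2) * circle_weight k1 k2 \<theta>)"
  proof
    fix \<theta>
    define t A' B' p' q' s where defs: "t = (1 - cos \<theta>) / 2" "A' = poly A t" "B' = poly B t"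
      "p' = poly p t" "q' = poly q t" "s = sin \<theta>"
    have c: "cos \<theta> = 1 - 2 * t" by (simp add: defs field_simps)
    have s: "s * s = 1 - (1 - 2 * t) * (1 - 2 * t)"
      using sin_squared_eq[of \<theta>] by (simp add: defs(6) c power2_eq_square)
    have re: "Re (cnj (of_real u * (1 - cis \<theta>) * of_real A' + of_real v * (1 + cis \<theta>) * of_real B') *
        (of_real p' + cis \<theta> * of_real q')) =
       (u * (1 - cos \<theta>) * A' + v * (1 + cos \<theta>) * B') * (p' + cos \<theta> * q') + 
       (v * B' - u * A') * q' * (s * s)"
      by (simp add: algebra_simps defs(6))
    have Re_mult_of_real: "Re (w * of_real r) = Re w * r" for w r by simp
    have "Re (?h \<theta>) = ((u * (1 - cos \<theta>) * A' + v * (1 + cos \<theta>) * B') * (p' + cos \<theta> * q') +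
       (v * B' - u * A') * q' * (s * s)) * circle_weight k1 k2 \<theta>"
      unfolding P Q Re_mult_of_real re[symmetric] unfolding defs ..
    also have "\<dots> = 2 * ((v * (1 - t) * B' + u * t * A') * p' + (v * (1 - t) * B' - u * t * A') * q')
      * circle_weight k1 k2 \<theta>"
      unfolding s c by (simp add: algebra_simps)
    finally show "Re (?h \<theta>) = poly (smult 2
    ((smult v ([:1, -1:] * B) + smult u ([:0, 1:] * A)) * p +
     (smult v ([:1, -1:] * B) - smult u ([:0, 1:] * A)) * q)) ((1 - cos \<theta>) / 2) * circle_weight k1 k2 \<theta>"
      unfolding defs(1)[symmetric] defs(2-5) by (simp add: algebra_simps)
  qed
  finally show ?thesis by (simp add: circle_int_def)
qed

text \<open>From z^2 = 2 z cos \<theta> - 1, multiplication by z turns the pair (p, q) into (-q, p +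
  (2-4t) q), as 2 cos \<theta> = 2 - 4t.\<close>

lemma cis_power_decomp:
  "\<exists>p q. degree p \<le> m \<and> degree q \<le> m \<and> (\<forall>\<theta>. cis \<theta> ^ Suc m =
    of_real (poly p ((1 - cos \<theta>) / 2)) + cis \<theta> * of_real (poly q ((1 - cos \<theta>) / 2)))"
proof (induction m)
  case 0
  show ?case by (rule exI[of _ 0], rule exI[of _ 1]) simp
next
  case (Suc m)
  then obtain p q where pq: "degree p \<le> m" "degree q \<le> m" and e: "\<And>\<theta>. cis \<theta> ^ Suc m =
    of_real (poly p ((1 - cos \<theta>) / 2)) + cis \<theta> * of_real (poly q ((1 - cos \<theta>) / 2))" by blast
  show ?case
  proof (intro exI conjI allI)
    show "degree (- q) \<le> Suc m" using pq by simp
    show "degree (p + [:2, -4:] * q) \<le> Suc m"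
      using pq degree_mult_le[of "[:2, -4 :: real:]" q] by (intro degree_add_le) auto
    fix \<theta>
    have *: "cis \<theta> * cis \<theta> = of_real (2 * cos \<theta>) * cis \<theta> - 1"
      using sin_cos_squared_add[of \<theta>] by (simp add: complex_eq_iff power2_eq_square)
    show "cis \<theta> ^ Suc (Suc m) = of_real (poly (- q) ((1 - cos \<theta>) / 2)) +
       cis \<theta> * of_real (poly (p + [:2, -4:] * q) ((1 - cos \<theta>) / 2))"
      unfolding power_Suc[of _ "Suc m"] e distrib_left mult.assoc[symmetric] *
      by (simp add: field_simps)
  qed
qed

text \<open>From 1/z = 2 cos \<theta> - z, multiplication by 1/z turns (p, q) into (q + (2-4t) p,
  -p). The alternative \<open>q = 0\<close> expresses degree below m also for
  \<open>m = 0\<close>.\<close>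

lemma cis_inverse_power_decomp:
  "\<exists>p q. degree p \<le> m \<and> (q = 0 \<or> degree q < m) \<and> (\<forall>\<theta>. inverse (cis \<theta>) ^ m =
    of_real (poly p ((1 - cos \<theta>) / 2)) + cis \<theta> * of_real (poly q ((1 - cos \<theta>) / 2)))"
proof (induction m)
  case 0
  show ?case by (rule exI[of _ 1], rule exI[of _ 0]) simp
next
  case (Suc m)
  then obtain p q where pq: "degree p \<le> m" "q = 0 \<or> degree q < m" and e: "\<And>\<theta>. inverse (cis \<theta>) ^ m =
    of_real (poly p ((1 - cos \<theta>) / 2)) + cis \<theta> * of_real (poly q ((1 - cos \<theta>) / 2))" by blast
  show ?case
  proof (intro exI conjI allI)
    show "degree (q + [:2, -4:] * p) \<le> Suc m"
      using pq degree_mult_le[of "[:2, -4 :: real:]" p] by (intro degree_add_le) auto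
    show "- p = 0 \<or> degree (- p) < Suc m" using pq by simp
    fix \<theta>
    have *: "inverse (cis \<theta>) = of_real (2 * cos \<theta>) - cis \<theta>"
      by (simp add: complex_eq_iff)
    have inv: "inverse (cis \<theta>) * cis \<theta> = 1" by (simp add: cis_mult)
    have "inverse (cis \<theta>) ^ Suc m = inverse (cis \<theta>) * of_real (poly p ((1 - cos \<theta>) / 2)) +
        (inverse (cis \<theta>) * cis \<theta>) * of_real (poly q ((1 - cos \<theta>) / 2))"
      unfolding power_Suc e by (simp only: distrib_left mult.assoc)
    also have "\<dots> = of_real (poly (q + [:2, -4:] * p) ((1 - cos \<theta>) / 2)) +
       cis \<theta> * of_real (poly (- p) ((1 - cos \<theta>) / 2))"
      unfolding inv unfolding * by (simp add: field_simps)
    finally show "inverse (cis \<theta>) ^ Suc m = of_real (poly (q + [:2, -4:] * p) ((1 - cos \<theta>) / 2)) +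
       cis \<theta> * of_real (poly (- p) ((1 - cos \<theta>) / 2))" .
  qed
qed

section \<open>The non-symmetric polynomials\<close>

text \<open>Within the window only z^(-M) may need a \<open>p\<close> of degree M. This isolates the
  one monomial for which the choice of c matters.\<close>

lemma laurent_monom_cis_decomp:
  fixes j :: int
  assumes "- int M \<le> j" "j \<le> int M"
  obtains p q where "degree p \<le> M" "j \<noteq> - int M \<Longrightarrow> degree p < M" "q = 0 \<or> degree q < M"
    "\<And>\<theta>. laurent_eval (laurent_monom j) (cis \<theta>) =
      of_real (poly p ((1 - cos \<theta>) / 2)) + cis \<theta> * of_real (poly q ((1 - cos \<theta>) / 2))"
proof (cases "j > 0")
  case True
  define m where "m = nat (j - 1)"
  have j: "j = int (Suc m)" and m: "m < M" using True assms by (auto simp: m_def)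
  obtain p q where "degree p \<le> m" "degree q \<le> m" "\<And>\<theta>. cis \<theta> ^ Suc m =
    of_real (poly p ((1 - cos \<theta>) / 2)) + cis \<theta> * of_real (poly q ((1 - cos \<theta>) / 2))"
    using cis_power_decomp[of m] by blast
  with m show ?thesis
    by (intro that[of p q]) (auto simp: j power_int_def nat_add_distrib)
next
  case False
  define m where "m = nat (- j)"
  have j: "j = - int m" and m: "m \<le> M" using False assms by (auto simp: m_def)
  obtain p q where "degree p \<le> m" "q = 0 \<or> degree q < m" "\<And>\<theta>. inverse (cis \<theta>) ^ m =
    of_real (poly p ((1 - cos \<theta>) / 2)) + cis \<theta> * of_real (poly q ((1 - cos \<theta>) / 2))"
    using cis_inverse_power_decomp[of m] by blast
  with m show ?thesis
    by (intro that[of p q]) (auto simp: j power_int_minus power_inverse simp del: cis_inverse)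
qed

text \<open>A criterion for recognising E(n,k): the monomials below z^n fill an interval of
  exponents, so both defining conditions can be checked on the function \<open>f\<close>.\<close>

lemma laurent_eval_nonsym_jacobi_E:
  assumes "k1 \<ge> 0" "k2 \<ge> 0" "z \<noteq> 0"
    and span: "laurent_span l u (\<lambda>z. f z - z powi n)"
    and less: "\<And>j. monom_less j n \<longleftrightarrow> l \<le> j \<and> j \<le> u"
    and orth: "\<And>P j. (\<And>z. z \<noteq> 0 \<Longrightarrow> laurent_eval P z = f z) \<Longrightarrow> l \<le> j \<Longrightarrow> j \<le> u \<Longrightarrow>
       inner_k (k1, k2) P (laurent_monom j) = 0"
  shows "laurent_eval (nonsym_jacobi_E n (k1, k2)) z = f z"
proof -
  obtain q where q: "Poly_Mapping.keys q \<subseteq> {l..u}" "\<And>z. z \<noteq> 0 \<Longrightarrow> laurent_eval q z = f z - z powi n"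
    using laurent_span_imp_laurent_poly[OF span] by blast
  define P where "P = laurent_monom n + q"
  have P: "laurent_eval P z = f z" if "z \<noteq> 0" for z
    using q(2)[OF that] by (simp add: P_def laurent_eval_add)
  have "is_nonsym_jacobi n (k1, k2) P"
    unfolding is_nonsym_jacobi_def less
    using q(1) orth[OF P] by (auto simp: P_def intro!: exI[of _ q])
  then show ?thesis
    using nonsym_jacobi_E_eqI assms(1,2) P[OF \<open>z \<noteq> 0\<close>] by simp
qed

lemma coeff_jacobi_poly_degree:
  assumes "a > -1"
  shows "coeff (jacobi_poly n a b) n = (-1) ^ n * pochhammer (real n + a + b + 1) n / fact n"
proof -
  have "pochhammer (a + 1) n > 0" using assms by (auto intro!: pochhammer_pos)
  moreover have "pochhammer (- real n) n = (-1) ^ n * fact n"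
    by (simp add: pochhammer_minus pochhammer_fact)
  ultimately show ?thesis by (simp add: coeff_jacobi_poly)
qed

lemma jacobi_P_eq_poly:
  "jacobi_P n a b (of_real (cos \<theta>)) = of_real (poly (jacobi_poly n a b) ((1 - cos \<theta>) / 2))"
  by (simp add: jacobi_P_eq_sum poly_atMost_sum[OF degree_jacobi_poly_le])

theorem corollary2p6:
  fixes N :: nat and k :: "real \<times> real" and k1 k2 \<alpha> \<beta> :: real and z x :: complex
  assumes k: "k = (k1, k2)" and k1: "k1 \<ge> 0" and k2: "k2 \<ge> 0"
    and \<alpha>: "\<alpha> = k1 + k2 - 1/2"
    and \<beta>: "\<beta> = k2 - 1/2"
    and z: "z \<noteq> 0"
    and x: "x = (z + inverse z) / 2"
  shows "laurent_eval (nonsym_jacobi_E (- int N) k) z =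
      complex_of_real (2 powi (2 * int N - 1) * fact N / pochhammer (real N + \<alpha> + \<beta> + 2) N) *
        (jacobi_P N (\<alpha> + 1) \<beta> x + jacobi_P N \<alpha> (\<beta> + 1) x
         - z * (jacobi_P N (\<alpha> + 1) \<beta> x - jacobi_P N \<alpha> (\<beta> + 1) x))
    \<and> laurent_eval (nonsym_jacobi_E (int N + 1) k) z =
      z * complex_of_real (2 powi (2 * int N - 1) * fact N / pochhammer (real N + \<alpha> + \<beta> + 2) N) *
        (jacobi_P N (\<alpha> + 1) \<beta> x + jacobi_P N \<alpha> (\<beta> + 1) x
         - complex_of_real (c_coeff N k) *
             (jacobi_P N (\<alpha> + 1) \<beta> x - jacobi_P N \<alpha> (\<beta> + 1) x))
      + complex_of_real (2 powi (2 * int N - 1) * fact N / pochhammer (real N + \<alpha> + \<beta> + 2) N) *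
        (complex_of_real (c_coeff N k) *
             (jacobi_P N (\<alpha> + 1) \<beta> x + jacobi_P N \<alpha> (\<beta> + 1) x)
         - jacobi_P N (\<alpha> + 1) \<beta> x + jacobi_P N \<alpha> (\<beta> + 1) x)"
proof -
  define A B where "A = jacobi_poly N (\<alpha> + 1) \<beta>" and "B = jacobi_poly N \<alpha> (\<beta> + 1)"
  define K where "K = 2 powi (2 * int N - 1) * fact N / pochhammer (real N + \<alpha> + \<beta> + 2) N"
  define c where "c = c_coeff N k"
  define l where "l = coeff B N"
  define a where "a z = jacobi_P N (\<alpha> + 1) \<beta> ((z + inverse z) / 2)" for z
  define b where "b z = jacobi_P N \<alpha> (\<beta> + 1) ((z + inverse z) / 2)" for z
  \<comment> \<open>The parts of \<open>a\<close> and \<open>b\<close> below t^N; the power t^N is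
    treated separately because of its extreme monomial.\<close>
  define a' where "a' z = (\<Sum>j<N. complex_of_real (coeff A j) * jacobi_var z ^ j)" for z
  define b' where "b' z = (\<Sum>j<N. complex_of_real (coeff B j) * jacobi_var z ^ j)" for z
  have par: "\<alpha> > -1" "\<alpha> + \<beta> + 1 \<ge> 0" "\<beta> > -1" using k1 k2 by (auto simp: \<alpha> \<beta>)

  interpret J: jacobi_functional \<alpha> \<beta> "circle_int k1 k2"
    unfolding \<alpha> \<beta> by (rule jacobi_functional_circle_int[OF k1 k2])
  \<comment> \<open>Absorbing t into the functional shifts its parameters to (\<alpha>+1, \<beta>),
    those of \<open>A\<close>. The case \<open>q = 0\<close> is separate because no degree is below
    \<open>N = 0\<close>.\<close>
  have orth_A: "circle_int k1 k2 ([:0, 1:] * A * q) = 0" if "q = 0 \<or> degree q < N" for q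
    using that jacobi_functional.jacobi_poly_orth[OF J.shift_left, of q N] par
    by (auto simp: A_def mult.assoc J.zero simp del: mult_pCons_left)
  have orth_B: "circle_int k1 k2 ([:1, -1:] * B * q) = 0" if "q = 0 \<or> degree q < N" for q
    using that jacobi_functional.jacobi_poly_orth[OF J.shift_right, of q N] par
    by (auto simp: B_def mult.assoc J.zero simp del: mult_pCons_left)

  have ab_cis: "a (cis \<theta>) = of_real (poly A ((1 - cos \<theta>) / 2))"
    "b (cis \<theta>) = of_real (poly B ((1 - cos \<theta>) / 2))" for \<theta>
  proof -
    have "(cis \<theta> + inverse (cis \<theta>)) / 2 = of_real (cos \<theta>)" by (simp add: complex_eq_iff)
    then show "a (cis \<theta>) = of_real (poly A ((1 - cos \<theta>) / 2))"
      "b (cis \<theta>) = of_real (poly B ((1 - cos \<theta>) / 2))"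
      by (simp_all only: a_def b_def A_def B_def jacobi_P_eq_poly)
  qed
  \<comment> \<open>One statement serves both families. Only z^(-N) calls for the contiguous
    combination, as its \<open>p\<close> may have degree N, out of reach of the orthogonality of
    \<open>A\<close> and \<open>B\<close>.\<close>
  have orth: "inner_k (k1, k2) P (laurent_monom j) = 0"
    if P: "\<And>z. z \<noteq> 0 \<Longrightarrow> laurent_eval P z = of_real u * (1 - z) * a z + of_real v * (1 + z) * b z"
      and j: "- int N \<le> j" "j \<le> int N"
      and uv: "j = - int N \<Longrightarrow> (\<exists>d. smult v ([:1, -1:] * B) + smult u ([:0, 1:] * A) = smult d (jacobi_poly (Suc N) \<alpha> \<beta>))"
    for P u v j
  proof -
    obtain p q where pq: "degree p \<le> N" "j \<noteq> - int N \<Longrightarrow> degree p < N" "q = 0 \<or> degree q < N"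
      and Q: "\<And>\<theta>. laurent_eval (laurent_monom j) (cis \<theta>) =
        of_real (poly p ((1 - cos \<theta>) / 2)) + cis \<theta> * of_real (poly q ((1 - cos \<theta>) / 2))"
      using laurent_monom_cis_decomp[OF j] by blast
    let ?X = "smult v ([:1, -1:] * B)" and ?Y = "smult u ([:0, 1:] * A)"
    have q0: "circle_int k1 k2 ((?X - ?Y) * q) = 0"
      by (simp only: left_diff_distrib mult_smult_left J.diff J.smult orth_A[OF pq(3)] orth_B[OF pq(3)])
    have p0: "circle_int k1 k2 ((?X + ?Y) * p) = 0"
    proof (cases "j = - int N")
      case True
      then obtain d where d: "?X + ?Y = smult d (jacobi_poly (Suc N) \<alpha> \<beta>)" using uv by blast
      show ?thesis unfolding d mult_smult_left J.smult
        using J.jacobi_poly_orth[of p "Suc N"] par pq(1) by simp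
    next
      case False
      then have "p = 0 \<or> degree p < N" using pq by blast
      then show ?thesis
        by (simp only: distrib_right mult_smult_left J.add J.smult orth_A orth_B)
    qed
    have "inner_k (k1, k2) P (laurent_monom j) =
      of_real (circle_int k1 k2 (smult 2 ((?X + ?Y) * p + (?X - ?Y) * q)))"
      by (rule inner_k_eq_circle_int[OF k1 k2 _ Q]) (simp add: P ab_cis)
    also have "\<dots> = 0" by (simp only: J.add J.smult p0 q0) simp
    finally show ?thesis .
  qed

  have lA: "coeff A N = l" using par by (simp add: A_def B_def l_def coeff_jacobi_poly_shift)
  have split: "a z = a' z + of_real l * jacobi_var z ^ N" "b z = b' z + of_real l * jacobi_var z ^ N" for z
    using lA by (simp_all add: a_def b_def a'_def b'_def jacobi_P_eq_sum jacobi_var_def l_def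
        flip: lessThan_Suc_atMost A_def B_def)
  \<comment> \<open>The normalisation that fixes \<open>K\<close>: \<open>A\<close> and
    \<open>B\<close> share the leading coefficient \<open>l\<close>, and the extreme monomials of
    t^N have coefficient (-1/4)^N.\<close>
  have Kl: "2 * K * l * (-1/4) ^ N = 1"
  proof -
    have "pochhammer (real N + \<alpha> + \<beta> + 2) N > 0"
      using par by (intro pochhammer_pos) linarith
    moreover have "l = (-1) ^ N * pochhammer (real N + \<alpha> + \<beta> + 2) N / fact N"
      using par by (simp add: l_def B_def coeff_jacobi_poly_degree add_ac)
    moreover have "2 powi (2 * int N - 1) = (4 ^ N / 2 :: real)"
      by (simp add: power_int_diff power_int_mult)
    moreover have "(-1/4) ^ N * 4 ^ N * (-1) ^ N = (1 :: real)"
      by (simp flip: power_mult_distrib)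
    ultimately show ?thesis by (simp add: K_def mult_ac)
  qed
  have Kl': "2 * of_real K * of_real l * (-1/4) ^ N = (1 :: complex)"
    using arg_cong[OF Kl, of complex_of_real] by simp

  have span_a': "laurent_span l' u' a'" "laurent_span l' u' b'" if "l' \<le> 1 - int N" "int N - 1 \<le> u'" for l' u'
    unfolding a'_def b'_def using that by (intro jacobi_var_lessThan_sum; simp)+
  have span_za': "laurent_span l' u' (\<lambda>z. z * a' z)" "laurent_span l' u' (\<lambda>z. z * b' z)"
    if "l' \<le> 2 - int N" "int N \<le> u'" for l' u'
    using laurent_span_mono[OF laurent_span_shift[OF span_a'(1)[OF order_refl order_refl], of 1], of l' u']
      laurent_span_mono[OF laurent_span_shift[OF span_a'(2)[OF order_refl order_refl], of 1], of l' u'] that by auto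

  have 1: "laurent_eval (nonsym_jacobi_E (- int N) (k1, k2)) z =
    of_real K * (1 - z) * a z + of_real K * (1 + z) * b z"
  proof (rule laurent_eval_nonsym_jacobi_E[OF k1 k2 z])
    \<comment> \<open>In (1-z)a + (1+z)b = (a+b) - z(a-b) the powers t^N add up in a+b and cancel in
      a-b, so z^(-N) comes from t^N alone.\<close>
    have "laurent_span (1 - int N) (int N) (\<lambda>z.
      (2 * of_real K * of_real l) * (jacobi_var z ^ N - (-1/4) ^ N * z powi (- int N)) +
      of_real K * (a' z + b' z) - of_real K * (z * a' z - z * b' z))"
      by (intro laurent_span_add laurent_span_diff laurent_span_cmult jacobi_var_power_lowest span_a' span_za') auto
    then show "laurent_span (1 - int N) (int N)
       (\<lambda>z. of_real K * (1 - z) * a z + of_real K * (1 + z) * b z - z powi (- int N))"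
    proof (rule laurent_span_cong)
      fix z :: complex
      have "(2 * of_real K * of_real l) * (jacobi_var z ^ N - (-1/4) ^ N * z powi (- int N)) =
        2 * of_real K * of_real l * jacobi_var z ^ N - z powi (- int N)"
        using Kl' by (simp only: right_diff_distrib mult.assoc[symmetric]) simp
      then show "(2 * of_real K * of_real l) * (jacobi_var z ^ N - (-1/4) ^ N * z powi (- int N)) +
        of_real K * (a' z + b' z) - of_real K * (z * a' z - z * b' z) =
        of_real K * (1 - z) * a z + of_real K * (1 + z) * b z - z powi (- int N)"
        by (simp only: split) (simp add: algebra_simps)
    qed
    show "monom_less j (- int N) \<longleftrightarrow> 1 - int N \<le> j \<and> j \<le> int N" for j
      by (auto simp: monom_less_def)
    show "inner_k (k1, k2) P (laurent_monom j) = 0"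
      if "\<And>z. z \<noteq> 0 \<Longrightarrow> laurent_eval P z = of_real K * (1 - z) * a z + of_real K * (1 + z) * b z"
       "1 - int N \<le> j" "j \<le> int N" for P j
      \<comment> \<open>The window starts at 1 - N, so the premise of \<open>orth\<close> about
        z^(-N) holds vacuously.\<close>
      using that(2,3) by (intro orth[OF that(1)]) auto
  qed

  have 2: "laurent_eval (nonsym_jacobi_E (int N + 1) (k1, k2)) z =
    of_real (- (K * (1 - c))) * (1 - z) * a z + of_real (K * (1 + c)) * (1 + z) * b z"
  proof (rule laurent_eval_nonsym_jacobi_E[OF k1 k2 z])
    have top: "laurent_span (- int N) (int N) (\<lambda>z. z powi 1 * (jacobi_var z ^ N - (-1/4) ^ N * z powi int N))"
      by (rule laurent_span_mono[OF laurent_span_shift[OF jacobi_var_power_highest]]) auto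
    \<comment> \<open>In front of z t^N the factors K(1-c) and K(1+c) add up to 2K, which normalises
      z^(N+1); the terms without the factor z stay in the window, whatever c is.\<close>
    have "laurent_span (- int N) (int N) (\<lambda>z.
      (2 * of_real K * of_real l) * (z powi 1 * (jacobi_var z ^ N - (-1/4) ^ N * z powi int N)) +
      of_real (K * (1 - c)) * (z * a' z) + of_real (K * (1 + c)) * (z * b' z) +
      of_real (K * (c - 1)) * (a' z + of_real l * jacobi_var z ^ N) +
      of_real (K * (1 + c)) * (b' z + of_real l * jacobi_var z ^ N))"
      by (intro laurent_span_add laurent_span_diff laurent_span_cmult top jacobi_var_power span_a' span_za') auto
    then show "laurent_span (- int N) (int N)
       (\<lambda>z. of_real (- (K * (1 - c))) * (1 - z) * a z + of_real (K * (1 + c)) * (1 + z) * b z - z powi (int N + 1))"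
    proof (rule laurent_span_cong)
      fix z :: complex assume "z \<noteq> 0"
      have "(2 * of_real K * of_real l) * (z powi 1 * (jacobi_var z ^ N - (-1/4) ^ N * z powi int N)) =
        2 * of_real K * of_real l * (z * jacobi_var z ^ N) - (2 * of_real K * of_real l * (-1/4) ^ N) * (z * z powi int N)"
        by (simp add: algebra_simps)
      also have "\<dots> = 2 * of_real K * of_real l * (z * jacobi_var z ^ N) - z powi (int N + 1)"
        unfolding Kl' using \<open>z \<noteq> 0\<close> by (simp add: power_int_add)
      finally show "(2 * of_real K * of_real l) * (z powi 1 * (jacobi_var z ^ N - (-1/4) ^ N * z powi int N)) +
        of_real (K * (1 - c)) * (z * a' z) + of_real (K * (1 + c)) * (z * b' z) +
        of_real (K * (c - 1)) * (a' z + of_real l * jacobi_var z ^ N) +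
        of_real (K * (1 + c)) * (b' z + of_real l * jacobi_var z ^ N) =
        of_real (- (K * (1 - c))) * (1 - z) * a z + of_real (K * (1 + c)) * (1 + z) * b z - z powi (int N + 1)"
        by (simp only: split) (simp add: algebra_simps)
    qed
    show "monom_less j (int N + 1) \<longleftrightarrow> - int N \<le> j \<and> j \<le> int N" for j
      by (auto simp: monom_less_def)
    \<comment> \<open>\<open>d\<close> equals 1 + 2N + 2 rho(k), the denominator of
      \<open>c\<close>, and \<alpha> - \<beta> = k1. Hence 1 - c and 1 + c are proportional to N +
      \<beta> + 1 and N + \<alpha> + 1, the coefficients of the contiguous relation.\<close>
    define d where "d = 2 * real N + \<alpha> + \<beta> + 2"
    have "d > 0" using par by (simp add: d_def)
    have "c = (\<alpha> - \<beta>) / d"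
      unfolding c_def d_def c_coeff_def rho_def k \<alpha> \<beta> by (simp add: algebra_simps)
    then have "1 - c = 2 * (real N + \<beta> + 1) / d" "1 + c = 2 * (real N + \<alpha> + 1) / d"
      using \<open>d > 0\<close> by (simp_all add: d_def field_simps)
    then have uv: "- (K * (1 - c)) = - (2 * K / d) * (real N + \<beta> + 1)"
      "K * (1 + c) = 2 * K / d * (real N + \<alpha> + 1)"
      by simp_all
    have "smult (K * (1 + c)) ([:1, -1:] * B) + smult (- (K * (1 - c))) ([:0, 1:] * A) =
      smult (2 * K / d) (smult (real N + \<alpha> + 1) ([:1, -1:] * B) - smult (real N + \<beta> + 1) ([:0, 1:] * A))"
      unfolding uv by (simp only: smult_diff_right smult_smult) (simp del: mult_pCons_left)
    also have "\<dots> = smult (2 * K / d * (real N + 1)) (jacobi_poly (Suc N) \<alpha> \<beta>)"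
      unfolding A_def B_def jacobi_poly_contiguous[OF par(1)] by simp
    finally show "inner_k (k1, k2) P (laurent_monom j) = 0"
      if "\<And>z. z \<noteq> 0 \<Longrightarrow> laurent_eval P z =
        of_real (- (K * (1 - c))) * (1 - z) * a z + of_real (K * (1 + c)) * (1 + z) * b z"
       "- int N \<le> j" "j \<le> int N" for P j
      using that(2,3) by (intro orth[OF that(1)]) blast+
  qed

  show ?thesis
    unfolding k 1 2
    unfolding x k[symmetric] c_def[symmetric] K_def[symmetric] a_def[symmetric] b_def[symmetric]
    by (simp add: algebra_simps)
qed

end
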